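(* For any real numbers $0<\alpha<1$ and $\varepsilon>0$ there exists $n_0$ such that for every integer $n>n_0$ there is a family $\mathcal{A}\subseteq\mathcal{P}(X)$, where $X=\{1,2,\dots,n\}$, with $|\mathcal{A}|\leq(\alpha+\varepsilon)2^n$ and $c(\mathcal{A})\geq\alpha\, n!$.
   Context: For a positive integer $n$, let $X=\{1,2,\dots,n\}$ and let $\mathcal{P}(X)$ be its power set, ordered by inclusion. A maximal chain is a chain of $n+1$ elements in $\mathcal{P}(X)$, i.e. a collection $\emptyset=A_0\subset A_1\subset\dots\subset A_n=X$ with $|A_r|=r$ for each $r$ (it is maximal in $\mathcal{P}(X)$, not merely within a given family). For $\mathcal{A}\subseteq\mathcal{P}(X)$, $c(\mathcal{A})$ denotes the number of maximal chains in $\mathcal{A}$, that is, the number of maximal chains of $\mathcal{P}(X)$ all of whose $n+1$ members belong to $\mathcal{A}$. *)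

theory Defs
  imports Complex_Main
begin

(* A chain with n + 1 members in Pow {1..n} has exactly one member of each size 0, ..., n. *)
definition maximal_chains :: "nat \<Rightarrow> nat set set set" where
  "maximal_chains n = {C. subset.chain (Pow {1..n}) C \<and> card C = n + 1}"

definition num_maximal_chains :: "nat \<Rightarrow> nat set set \<Rightarrow> nat" where
  "num_maximal_chains n \<A> = card {C \<in> maximal_chains n. C \<subseteq> \<A>}"

end

theory Submission
  imports Defs "HOL-Combinatorics.Permutations" "HOL-Real_Asymp.Real_Asymp"
begin

text \<open>
  Nearly all subsets of \<open>X = {1..n}\<close> have a size within \<open>o(n)\<close> of \<open>n/2\<close>, so a family may contain all
  sets of any other size at negligible cost. What matters is the window of middle sizes, and as
  a maximal chain runs through the window it acquires only \<open>o(n)\<close> elements. It therefore seldom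
  acquires one of the finitely many elements of \<open>{1..k}\<close> there: for most chains the trace on
  \<open>{1..k}\<close> is the same for all members in the window. If the middle sets of the family are those
  whose trace lies in a collection \<open>S\<close> of \<open>J\<close> of the \<open>2 ^ k\<close> possible traces, then the family has
  density about \<open>J / 2 ^ k\<close>. For suitable \<open>S\<close> the proportion of maximal chains inside it is also
  at least about \<open>J / 2 ^ k\<close>, whereas independent random membership would lose almost every chain.
  Every \<open>\<alpha>\<close> in \<open>(0, 1)\<close> is closely approximated from above by such a fraction.

  The cost of the outer sets is Chebyshev's inequality (\<open>card_sets_outside_window\<close>), and the loss of
  chains is a union bound over the positions and elements concerned
  (\<open>card_permutations_hitting\<close>), chains being represented by permutations of \<open>X\<close>. A suitable
  \<open>S\<close> comes from averaging (\<open>exists_heavy_subset\<close>), which makes it unnecessary to count the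
  chains with a given trace.
\<close>

section \<open>Subsets of middle size\<close>

text \<open>
  This is \<open>2 ^ card X\<close> times the variance of a sum of independent signs. Adding an element to \<open>X\<close>
  replaces each deviation \<open>d\<close> by \<open>d + 1\<close> and \<open>d - 1\<close>, and \<open>(d + 1)\<^sup>2 + (d - 1)\<^sup>2 = 2 * d\<^sup>2 + 2\<close>.
\<close>

lemma sum_Pow_deviation_squared:
  assumes "finite X"
  shows "(\<Sum>A\<in>Pow X. (2 * int (card A) - int (card X))\<^sup>2) = int (card X) * 2 ^ card X"
  using assms
proof (induction X rule: finite_induct)
  case empty
  then show ?case by simp
next
  case (insert x F)
  define d where "d A = 2 * int (card A) - int (card F)" for A :: "'a set"
  have inj: "inj_on (insert x) (Pow F)"
    using insert.hyps by (auto simp: inj_on_def)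
  have disj: "Pow F \<inter> insert x ` Pow F = {}"
    using insert.hyps by auto
  have card_ins: "card (Set.insert x A) = Suc (card A)" if "A \<in> Pow F" for A
    using that insert.hyps by (metis PowD card_insert_disjoint finite_subset subsetD)
  have "(\<Sum>A\<in>Pow (Set.insert x F). (2 * int (card A) - int (card (Set.insert x F)))\<^sup>2)
      = (\<Sum>A\<in>Pow F. (d A - 1)\<^sup>2) + (\<Sum>A\<in>Pow F. (d A + 1)\<^sup>2)"
    unfolding Pow_insert
    by (subst sum.union_disjoint)
      (use insert.hyps disj inj card_ins
        in \<open>auto simp: sum.reindex d_def algebra_simps intro!: arg_cong2[where f="(+)"] sum.cong\<close>)
  also have "\<dots> = (\<Sum>A\<in>Pow F. 2 * (d A)\<^sup>2 + 2)"
    by (simp add: sum.distrib[symmetric] power2_eq_square algebra_simps)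
  also have "\<dots> = 2 * (\<Sum>A\<in>Pow F. (d A)\<^sup>2) + 2 * 2 ^ card F"
    using insert.hyps by (simp add: sum.distrib sum_distrib_left card_Pow)
  also have "\<dots> = int (card (Set.insert x F)) * 2 ^ card (Set.insert x F)"
    using insert by (simp add: d_def algebra_simps)
  finally show ?case .
qed

lemma card_sets_outside_window:
  assumes "finite X" "card X = n"
  shows "real (card {A \<in> Pow X. card A \<notin> {n div 2 - h..n div 2 + h}})
           \<le> real n * 2 ^ n / (2 * real h + 1)\<^sup>2"
proof -
  define B where "B = {A \<in> Pow X. card A \<notin> {n div 2 - h..n div 2 + h}}"
  have "int (card B) * (2 * int h + 1)\<^sup>2 = (\<Sum>A\<in>B. (2 * int h + 1)\<^sup>2)"
    by simp
  also have "\<dots> \<le> (\<Sum>A\<in>B. (2 * int (card A) - int n)\<^sup>2)"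
  proof (rule sum_mono)
    fix A assume "A \<in> B"
    then have "2 * int h + 1 \<le> \<bar>2 * int (card A) - int n\<bar>"
      by (auto simp: B_def)
    then show "(2 * int h + 1)\<^sup>2 \<le> (2 * int (card A) - int n)\<^sup>2"
      by (metis abs_le_square_iff abs_of_nonneg add_nonneg_nonneg mult_nonneg_nonneg of_nat_0_le_iff
          zero_le_numeral zero_le_one)
  qed
  also have "\<dots> \<le> (\<Sum>A\<in>Pow X. (2 * int (card A) - int n)\<^sup>2)"
    by (rule sum_mono2) (use assms in \<open>auto simp: B_def\<close>)
  also have "\<dots> = int n * 2 ^ n"
    using sum_Pow_deviation_squared[OF assms(1)] assms(2) by simp
  finally have "real_of_int (int (card B) * (2 * int h + 1)\<^sup>2) \<le> real_of_int (int n * 2 ^ n)"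
    by (simp only: of_int_le_iff)
  then have "real (card B) * (2 * real h + 1)\<^sup>2 \<le> real n * 2 ^ n"
    by simp
  moreover have "(2 * real h + 1)\<^sup>2 > 0"
    by (simp add: add_nonneg_pos)
  ultimately show ?thesis
    by (simp add: B_def pos_le_divide_eq)
qed

lemma card_sets_with_trace:
  assumes "finite X" "K \<subseteq> X" "S \<subseteq> Pow K"
  shows "card {A \<in> Pow X. A \<inter> K \<in> S} \<le> card S * 2 ^ (card X - card K)"
proof -
  have fin: "finite K" "finite S"
    using assms by (meson finite_Pow_iff finite_subset)+
  have "card {A \<in> Pow X. A \<inter> K \<in> S} \<le> card (S \<times> Pow (X - K))"
  proof (rule card_inj_on_le[where f = "\<lambda>A. (A \<inter> K, A - K)"])
    show "inj_on (\<lambda>A. (A \<inter> K, A - K)) {A \<in> Pow X. A \<inter> K \<in> S}"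
      by (rule inj_onI) (auto; blast)
  qed (use assms fin in auto)
  also have "\<dots> = card S * 2 ^ (card X - card K)"
    using assms fin by (simp add: card_cartesian_product card_Pow card_Diff_subset)
  finally show ?thesis .
qed

section \<open>Permutations and maximal chains\<close>

text \<open>
  Listing \<open>X\<close> in the order \<open>p 1, p 2, \<dots>, p n\<close>, the initial segments form a maximal chain, and
  the chain determines the list because \<open>p (Suc r)\<close> is what its member of size \<open>Suc r\<close> adds to its
  member of size \<open>r\<close>.
\<close>

lemma card_permutations_le_num_maximal_chains:
  "card {p. p permutes {1..n} \<and> (\<forall>r\<le>n. p ` {1..r} \<in> \<A>)} \<le> num_maximal_chains n \<A>"
proof -
  define chain where "chain p = (\<lambda>r. p ` {1..r}) ` {..n}" for p :: "nat \<Rightarrow> nat"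
  define P where "P = {p. p permutes {1..n} \<and> (\<forall>r\<le>n. p ` {1..r} \<in> \<A>)}"
  have card_seg: "card (p ` {1..r}) = r" if "p permutes {1..n}" for p r
    using card_image[OF inj_on_subset[OF permutes_inj[OF that] subset_UNIV]] by simp
  have "chain p \<in> {C \<in> maximal_chains n. C \<subseteq> \<A>}" if "p \<in> P" for p
  proof -
    have p: "p permutes {1..n}" and pA: "\<forall>r\<le>n. p ` {1..r} \<in> \<A>"
      using that by (auto simp: P_def)
    have "inj_on (\<lambda>r. p ` {1..r}) {..n}"
      by (rule inj_onI) (metis card_seg[OF p])
    then have "card (chain p) = n + 1"
      by (simp add: chain_def card_image)
    moreover have "p ` {1..r} \<subseteq> {1..n}" if "r \<le> n" for r
      using permutes_image[OF p] that by fastforce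
    moreover have "p ` {1..r} \<subseteq> p ` {1..s} \<or> p ` {1..s} \<subseteq> p ` {1..r}" for r s
      by (cases "r \<le> s") (auto intro!: image_mono)
    ultimately have "chain p \<in> maximal_chains n"
      unfolding maximal_chains_def subset_chain_def by (fastforce simp: chain_def)
    then show ?thesis
      using pA by (auto simp: chain_def)
  qed
  moreover have "inj_on chain P"
  proof (rule inj_onI)
    fix p q assume "p \<in> P" "q \<in> P" and eq: "chain p = chain q"
    then have p: "p permutes {1..n}" and q: "q permutes {1..n}"
      by (auto simp: P_def)
    have seg: "p ` {1..r} = q ` {1..r}" if "r \<le> n" for r
    proof -
      have "p ` {1..r} \<in> chain q"
        using that eq by (auto simp: chain_def)
      then obtain s where "p ` {1..r} = q ` {1..s}"
        by (auto simp: chain_def)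
      then show ?thesis
        using card_seg[OF p, of r] card_seg[OF q, of s] by simp
    qed
    have added: "f ` {1..Suc r} - f ` {1..r} = {f (Suc r)}" if "f permutes {1..n}" for f r
    proof -
      have "{1..Suc r} - {1..r} = {Suc r}"
        by auto
      then show ?thesis
        using image_set_diff[OF permutes_inj[OF that], of "{1..Suc r}" "{1..r}"] by simp
    qed
    show "p = q"
    proof
      fix x
      show "p x = q x"
      proof (cases "x \<in> {1..n}")
        case True
        then obtain r where "x = Suc r" "Suc r \<le> n"
          by (cases x) auto
        then show ?thesis
          using added[OF p, of r] added[OF q, of r] seg[of r] seg[of "Suc r"] by simp
      next
        case False
        then show ?thesis
          using p q by (simp add: permutes_not_in)
      qed
    qed
  qed
  moreover have "finite {C \<in> maximal_chains n. C \<subseteq> \<A>}"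
  proof (rule finite_subset)
    show "{C \<in> maximal_chains n. C \<subseteq> \<A>} \<subseteq> Pow (Pow {1..n})"
      by (auto simp: maximal_chains_def subset_chain_def)
  qed simp
  ultimately show ?thesis
    unfolding num_maximal_chains_def P_def[symmetric] by (intro card_inj_on_le) auto
qed

text \<open>
  The value of a permutation at a given point is uniformly distributed, because composing with
  a transposition matches the permutations with value \<open>j\<close> with those with value \<open>i\<close>.
\<close>

lemma card_permutations_with_value:
  assumes "finite X" "m \<in> X" "i \<in> X"
  shows "card X * card {p. p permutes X \<and> p m = i} = fact (card X)"
proof -
  define Q where "Q j = {p. p permutes X \<and> p m = j}" for j
  have fin: "finite {p. p permutes X}"
    using assms by (simp add: finite_permutations)
  have finQ: "finite (Q j)" for j
    using fin by (rule rev_finite_subset) (auto simp: Q_def)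
  have le: "card (Q j) \<le> card (Q l)" if "j \<in> X" "l \<in> X" for j l
  proof (rule card_inj_on_le[where f = "\<lambda>p. transpose j l \<circ> p"])
    show "inj_on ((\<circ>) (transpose j l)) (Q j)"
      by (rule inj_onI) (metis comp_assoc id_comp transpose_comp_involutory)
    show "(\<circ>) (transpose j l) ` Q j \<subseteq> Q l"
      using that by (auto simp: Q_def intro!: permutes_compose permutes_swap_id)
  qed (rule finQ)
  have "(\<Union>j\<in>X. Q j) = {p. p permutes X}"
    using assms(2) by (auto simp: Q_def permutes_in_image)
  then have "fact (card X) = card (\<Union>j\<in>X. Q j)"
    using card_permutations[OF refl assms(1)] by simp
  also have "\<dots> = (\<Sum>j\<in>X. card (Q j))"
    using assms(1) finQ by (intro card_UN_disjoint) (auto simp: Q_def)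
  also have "\<dots> = (\<Sum>j\<in>X. card (Q i))"
    using le assms(3) by (intro sum.cong refl antisym) auto
  finally show ?thesis
    by (simp add: Q_def)
qed

lemma card_permutations_hitting:
  assumes "finite X" "M \<subseteq> X" "K \<subseteq> X"
  shows "card X * card {p. p permutes X \<and> (\<exists>m\<in>M. p m \<in> K)} \<le> card M * card K * fact (card X)"
proof -
  define Q where "Q = (\<lambda>(m, i). {p. p permutes X \<and> p m = i})"
  have fin: "finite M" "finite K"
    using assms finite_subset by auto
  have "{p. p permutes X \<and> (\<exists>m\<in>M. p m \<in> K)} = (\<Union>z\<in>M \<times> K. Q z)"
    by (auto simp: Q_def)
  then have "card {p. p permutes X \<and> (\<exists>m\<in>M. p m \<in> K)} \<le> (\<Sum>z\<in>M \<times> K. card (Q z))"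
    using fin by (simp add: card_UN_le)
  then have "card X * card {p. p permutes X \<and> (\<exists>m\<in>M. p m \<in> K)} \<le> (\<Sum>z\<in>M \<times> K. card X * card (Q z))"
    by (simp add: sum_distrib_left[symmetric])
  also have "\<dots> = (\<Sum>z\<in>M \<times> K. fact (card X))"
    using assms by (intro sum.cong refl) (auto simp: Q_def card_permutations_with_value subset_iff)
  finally show ?thesis
    by (simp add: card_cartesian_product)
qed

section \<open>Choosing the traces by averaging\<close>

text \<open>
  Discarding an element of least weight cannot lower the average weight of those that remain.
\<close>

lemma exists_heavy_subset:
  fixes f :: "'a \<Rightarrow> real"
  assumes "finite U" "J \<le> card U"
  shows "\<exists>S\<subseteq>U. card S = J \<and> real J * sum f U \<le> real (card U) * sum f S"
  using assms(2)
proof (induction J rule: inc_induct)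
  case base
  then show ?case by auto
next
  case (step J)
  then obtain S where S: "S \<subseteq> U" "card S = Suc J"
    and avg: "real (Suc J) * sum f U \<le> real (card U) * sum f S"
    by auto
  have finS: "finite S" "S \<noteq> {}"
    using S assms(1) finite_subset by auto
  then obtain x where x: "x \<in> S" "\<And>y. y \<in> S \<Longrightarrow> f x \<le> f y"
    using arg_min_if_finite(1)[OF finS, of f] arg_min_least[OF finS, of _ f] by metis
  have "real (card S) * f x \<le> sum f S"
    using sum_bounded_below[of S "f x" f] x by simp
  then have "real J * sum f S \<le> real (Suc J) * sum f (S - {x})"
    using x S finS by (simp add: sum_diff1 algebra_simps)
  then have "real (card U) * (real J * sum f S) \<le> real (card U) * (real (Suc J) * sum f (S - {x}))"
    by (rule mult_left_mono) simp
  moreover have "real J * (real (Suc J) * sum f U) \<le> real J * (real (card U) * sum f S)"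
    using avg by (rule mult_left_mono) simp
  ultimately have "real (Suc J) * (real J * sum f U) \<le> real (Suc J) * (real (card U) * sum f (S - {x}))"
    by (simp only: mult_ac)
  then have "real J * sum f U \<le> real (card U) * sum f (S - {x})"
    by (simp only: mult_le_cancel_left)
  then show ?case
    using S x finS by (intro exI[of _ "S - {x}"]) auto
qed

section \<open>The family\<close>

text \<open>
  Here \<open>2 * h + 1\<close> is the width of the window. A small \<open>h\<close> makes the sets outside the window
  numerous, whence the first term of the density, and a large \<open>h\<close> lets many chains change their
  trace on \<open>{1..k}\<close> inside the window, whence the subtracted term of the proportion.
\<close>

lemma exists_family:
  fixes n k J h :: nat
  assumes "0 < n" "k \<le> n" "J \<le> 2 ^ k"
  shows "\<exists>\<A>\<subseteq>Pow {1..n}.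
      real (card \<A>) \<le> (real n / (2 * real h + 1)\<^sup>2 + real J / 2 ^ k) * 2 ^ n \<and>
      real (num_maximal_chains n \<A>)
        \<ge> real J / 2 ^ k * (1 - real k * (2 * real h + 1) / real n) * fact n"
proof -
  define K where "K = {1..k}"
  define W where "W = {n div 2 - h..n div 2 + h}"
  define M where "M = W \<inter> {1..n}"
  define hits where "hits = {p. p permutes {1..n} \<and> (\<exists>m\<in>M. p m \<in> K)}"
  define misses where "misses = {p. p permutes {1..n} \<and> (\<forall>m\<in>M. p m \<notin> K)}"
  \<comment> \<open>The window is an interval around \<open>n div 2\<close>, so for the permutations in \<open>misses\<close> this is the
    trace at every size in the window.\<close>
  define trace where "trace p = p ` {1..n div 2} \<inter> K" for p :: "nat \<Rightarrow> nat"
  have finP: "finite {p. p permutes {1..n}}"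
    by (simp add: finite_permutations)
  have finm: "finite misses" "finite hits"
    using finP by (auto simp: misses_def hits_def)
  have trace_eq: "p ` {1..r} \<inter> K = trace p" if "p \<in> misses" "r \<in> W" "r \<le> n" for p r
  proof -
    have "m \<le> r \<longleftrightarrow> m \<le> n div 2" if "1 \<le> m" "p m \<in> K" for m
    proof (rule ccontr)
      assume "\<not> ?thesis"
      with \<open>r \<in> W\<close> \<open>r \<le> n\<close> \<open>1 \<le> m\<close> have "m \<in> M"
        by (auto simp: W_def M_def)
      then show False
        using \<open>p \<in> misses\<close> \<open>p m \<in> K\<close> by (auto simp: misses_def)
    qed
    then show ?thesis
      by (auto simp: trace_def)
  qed

  obtain S where S: "S \<subseteq> Pow K" "card S = J"
    and heavy: "real J * (\<Sum>T\<in>Pow K. real (card {p \<in> misses. trace p = T}))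
        \<le> real (card (Pow K)) * (\<Sum>T\<in>S. real (card {p \<in> misses. trace p = T}))"
    using exists_heavy_subset[of "Pow K" J "\<lambda>T. real (card {p \<in> misses. trace p = T})"] assms
    by (auto simp: K_def card_Pow)
  have finS: "finite S"
    using S finite_subset by (fastforce simp: K_def)
  have fibres: "(\<Sum>T\<in>R. card {p \<in> misses. trace p = T}) = card {p \<in> misses. trace p \<in> R}"
    if "finite R" for R
  proof -
    have "{p \<in> misses. trace p \<in> R} = (\<Union>T\<in>R. {p \<in> misses. trace p = T})"
      by auto
    then show ?thesis
      using that finm by (simp only:) (subst card_UN_disjoint, auto)
  qed
  have "{p \<in> misses. trace p \<in> Pow K} = misses"
    by (auto simp: trace_def)
  then have heavy': "real J * real (card misses) \<le> 2 ^ k * real (card {p \<in> misses. trace p \<in> S})"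
    using heavy fibres[of "Pow K"] fibres[OF finS]
    by (simp add: K_def card_Pow flip: of_nat_sum)

  define \<A> where "\<A> = {A \<in> Pow {1..n}. card A \<notin> W \<or> A \<inter> K \<in> S}"
  have "card \<A> \<le> card {A \<in> Pow {1..n}. card A \<notin> W} + card {A \<in> Pow {1..n}. A \<inter> K \<in> S}"
    unfolding \<A>_def by (rule order_trans[OF _ card_Un_le]) (auto intro!: card_mono)
  then have "real (card \<A>) \<le> real (card {A \<in> Pow {1..n}. card A \<notin> W})
      + real (card {A \<in> Pow {1..n}. A \<inter> K \<in> S})"
    by linarith
  moreover have "real (card {A \<in> Pow {1..n}. card A \<notin> W}) \<le> real n * 2 ^ n / (2 * real h + 1)\<^sup>2"
    unfolding W_def by (rule card_sets_outside_window) auto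
  moreover have "card {A \<in> Pow {1..n}. A \<inter> K \<in> S} \<le> J * 2 ^ (n - k)"
    using card_sets_with_trace[of "{1..n}" K S] S assms(2) by (simp add: K_def)
  then have "real (card {A \<in> Pow {1..n}. A \<inter> K \<in> S}) \<le> real (J * 2 ^ (n - k))"
    by (simp only: of_nat_le_iff)
  then have "real (card {A \<in> Pow {1..n}. A \<inter> K \<in> S}) \<le> real J / 2 ^ k * 2 ^ n"
    using power_diff[of "2 :: real" k n] assms(2) by simp
  ultimately have size:
    "real (card \<A>) \<le> (real n / (2 * real h + 1)\<^sup>2 + real J / 2 ^ k) * 2 ^ n"
    by (simp add: distrib_right)

  have "{p \<in> misses. trace p \<in> S} \<subseteq> {p. p permutes {1..n} \<and> (\<forall>r\<le>n. p ` {1..r} \<in> \<A>)}"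
  proof (intro subsetI CollectI conjI allI impI)
    fix p r assume p: "p \<in> {p \<in> misses. trace p \<in> S}"
    then show perm: "p permutes {1..n}"
      by (simp add: misses_def)
    assume "r \<le> n"
    have "card (p ` {1..r}) = r"
      using card_image[OF inj_on_subset[OF permutes_inj[OF perm] subset_UNIV]] by simp
    moreover have "p ` {1..r} \<subseteq> {1..n}"
      using permutes_image[OF perm] \<open>r \<le> n\<close> by fastforce
    ultimately show "p ` {1..r} \<in> \<A>"
      using trace_eq[of p r] p \<open>r \<le> n\<close> by (auto simp: \<A>_def)
  qed
  then have "card {p \<in> misses. trace p \<in> S} \<le> num_maximal_chains n \<A>"
    using finP by (intro order_trans[OF card_mono card_permutations_le_num_maximal_chains]) auto
  moreover have "real J / 2 ^ k * real (card misses) \<le> real (card {p \<in> misses. trace p \<in> S})"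
    using heavy' by (simp add: divide_simps mult_ac)
  ultimately have chains: "real J / 2 ^ k * real (card misses) \<le> real (num_maximal_chains n \<A>)"
    by linarith

  have "misses \<union> hits = {p. p permutes {1..n}}" "misses \<inter> hits = {}"
    by (auto simp: misses_def hits_def)
  then have "card misses + card hits = fact n"
    using finm card_permutations[of "{1..n}" n] by (simp flip: card_Un_disjoint)
  then have total: "real (card misses) = fact n - real (card hits)"
    by (metis add_diff_cancel_right' of_nat_add of_nat_fact)
  have "n * card hits \<le> card M * k * fact n"
    using card_permutations_hitting[of "{1..n}" M K] assms(2)
    by (auto simp: hits_def M_def K_def)
  also have "card M \<le> 2 * h + 1"
    by (rule order_trans[OF card_mono[of W]]) (auto simp: M_def W_def)
  finally have "n * card hits \<le> (2 * h + 1) * k * fact n"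
    by simp
  then have "real (n * card hits) \<le> real ((2 * h + 1) * k * fact n)"
    by (simp only: of_nat_le_iff)
  then have "real (card hits) \<le> real k * (2 * real h + 1) / real n * fact n"
    using assms(1) by (simp add: field_simps)
  then have "(1 - real k * (2 * real h + 1) / real n) * fact n \<le> real (card misses)"
    using total by (simp add: algebra_simps)
  then have "real J / 2 ^ k * ((1 - real k * (2 * real h + 1) / real n) * fact n)
      \<le> real J / 2 ^ k * real (card misses)"
    by (rule mult_left_mono) simp
  then have "real J / 2 ^ k * (1 - real k * (2 * real h + 1) / real n) * fact n
      \<le> real (num_maximal_chains n \<A>)"
    using chains by (simp add: mult.assoc)
  then show ?thesis
    using size by (intro exI[of _ \<A>]) (auto simp: \<A>_def)
qed

lemma exists_dyadic_between:
  fixes a b :: real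
  assumes "0 \<le> a" "a < b"
  obtains k J :: nat where "a < real J / 2 ^ k" "real J / 2 ^ k < b"
proof -
  obtain k where k: "(1 / 2 :: real) ^ k < b - a"
    using real_arch_pow_inv[of "b - a" "1 / 2"] assms by auto
  define J where "J = nat \<lfloor>a * 2 ^ k\<rfloor> + 1"
  have "a * 2 ^ k < real J" "real J \<le> a * 2 ^ k + 1"
    using assms by (auto simp: J_def) linarith+
  then have "a < real J / 2 ^ k" "real J / 2 ^ k \<le> a + (1 / 2) ^ k"
    by (simp_all add: field_simps power_divide)
  then show ?thesis
    using k by (intro that[of J k]) auto
qed

theorem theorem4:
  fixes \<alpha> \<epsilon> :: real
  assumes "0 < \<alpha>" and "\<alpha> < 1" and "\<epsilon> > 0"
  shows "\<exists>n0::nat. \<forall>n>n0. \<exists>\<A> \<subseteq> Pow {1..n}.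
           real (card \<A>) \<le> (\<alpha> + \<epsilon>) * 2 ^ n \<and>
           real (num_maximal_chains n \<A>) \<ge> \<alpha> * fact n"
proof -
  obtain k J :: nat where kJ: "\<alpha> < real J / 2 ^ k" "real J / 2 ^ k < min 1 (\<alpha> + \<epsilon>)"
    by (rule exists_dyadic_between[of \<alpha> "min 1 (\<alpha> + \<epsilon>)"]) (use assms in auto)
  have "real J < 2 ^ k"
    using kJ(2) by (simp add: field_simps)
  then have J: "J \<le> 2 ^ k"
    by (metis less_imp_le of_nat_le_iff of_nat_numeral of_nat_power)
  \<comment> \<open>Any width between the orders \<open>sqrt n\<close>, for few sets outside the window, and \<open>n\<close>, for few
    chains acquiring an element of \<open>{1..k}\<close> inside it, would do.\<close>
  define h where "h n = nat \<lfloor>real n powr (3 / 4)\<rfloor>" for n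
  have "(\<lambda>n. real n / (2 * real (h n) + 1)\<^sup>2 + real J / 2 ^ k) \<longlonglongrightarrow> 0 + real J / 2 ^ k"
    unfolding h_def by (intro tendsto_add tendsto_const) real_asymp
  then have size: "\<forall>\<^sub>F n in sequentially. real n / (2 * real (h n) + 1)\<^sup>2 + real J / 2 ^ k < \<alpha> + \<epsilon>"
    using kJ by (intro order_tendstoD(2)) auto
  have "(\<lambda>n. (2 * real (h n) + 1) / real n) \<longlonglongrightarrow> 0"
    unfolding h_def by real_asymp
  then have "(\<lambda>n. real J / 2 ^ k * (1 - real k * ((2 * real (h n) + 1) / real n)))
      \<longlonglongrightarrow> real J / 2 ^ k * (1 - real k * 0)"
    by (intro tendsto_intros)
  then have chains: "\<forall>\<^sub>F n in sequentially.
      \<alpha> < real J / 2 ^ k * (1 - real k * ((2 * real (h n) + 1) / real n))"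
    using kJ by (intro order_tendstoD(1)) auto
  have "\<forall>\<^sub>F n in sequentially. \<exists>\<A> \<subseteq> Pow {1..n}.
      real (card \<A>) \<le> (\<alpha> + \<epsilon>) * 2 ^ n \<and> real (num_maximal_chains n \<A>) \<ge> \<alpha> * fact n"
    using size chains eventually_gt_at_top[of 0] eventually_ge_at_top[of k]
  proof eventually_elim
    case (elim n)
    obtain \<A> where \<A>: "\<A> \<subseteq> Pow {1..n}"
      "real (card \<A>) \<le> (real n / (2 * real (h n) + 1)\<^sup>2 + real J / 2 ^ k) * 2 ^ n"
      "real (num_maximal_chains n \<A>)
        \<ge> real J / 2 ^ k * (1 - real k * (2 * real (h n) + 1) / real n) * fact n"
      using exists_family[OF elim(3,4) J, of "h n"] by auto
    have "(real n / (2 * real (h n) + 1)\<^sup>2 + real J / 2 ^ k) * 2 ^ n \<le> (\<alpha> + \<epsilon>) * 2 ^ n"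
      using elim(1) by (intro mult_right_mono) auto
    moreover have "\<alpha> * fact n
        \<le> real J / 2 ^ k * (1 - real k * (2 * real (h n) + 1) / real n) * fact n"
      using elim(2) by (intro mult_right_mono) auto
    ultimately show ?case
      using \<A> by (blast intro: order_trans)
  qed
  then show ?thesis
    by (simp only: eventually_at_top_dense)
qed

end
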